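(* Let $G$ be a connected graph with $\Delta(G)\geq 3$ and let $n$ be a positive integer with $n>2$. Then $\chi(G^{\frac{2}{n}})=\Delta(G)+1=\omega(G^{\frac{2}{n}})$.
   Context: All graphs are finite and simple; $\Delta$ is the maximum degree, $\chi$ the chromatic number, $\omega$ the clique number. For a graph $H$ and $m\in\mathbb{N}$, the $m$-power $H^m$ has vertex set $V(H)$, with distinct vertices $x,y$ adjacent iff $1\le d_H(x,y)\le m$. For $n\in\mathbb{N}$, the $n$-subdivision $G^{\frac1n}$ is obtained from $G$ by replacing each edge by a path of length $n$. The fractional power $G^{\frac{m}{n}}$ is $(G^{\frac1n})^m$ (the fraction is not reduced: $G^{\frac2n}$ is the square of the $n$-subdivision). *)

theory Defs
  imports "Graph_Theory.Graph_Theory"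
begin

text \<open>A finite simple graph is a \<^locale>\<open>pair_graph\<close>: finite, loop-free, and with a symmetric set of arcs,
  so that every undirected edge is present as two opposite arcs.\<close>

text \<open>By symmetry the out-degree is the number of neighbours.\<close>

definition max_degree :: "'a pair_pre_digraph \<Rightarrow> nat" where
  "max_degree G = Max (out_degree (with_proj G) ` pverts G)"

definition proper_coloring :: "'a pair_pre_digraph \<Rightarrow> nat \<Rightarrow> ('a \<Rightarrow> nat) \<Rightarrow> bool" where
  "proper_coloring G k c \<longleftrightarrow>
     (\<forall>v\<in>pverts G. c v < k) \<and> (\<forall>(u, v)\<in>parcs G. c u \<noteq> c v)"

definition chromatic_number :: "'a pair_pre_digraph \<Rightarrow> nat" where
  "chromatic_number G = (LEAST k. \<exists>c. proper_coloring G k c)"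

definition clique :: "'a pair_pre_digraph \<Rightarrow> 'a set \<Rightarrow> bool" where
  "clique G S \<longleftrightarrow> S \<subseteq> pverts G \<and> (\<forall>u\<in>S. \<forall>v\<in>S. u \<noteq> v \<longrightarrow> (u, v) \<in> parcs G)"

definition clique_number :: "'a pair_pre_digraph \<Rightarrow> nat" where
  "clique_number G = Max (card ` {S. clique G S})"

text \<open>The least number of arcs of a walk, infinite if there is none.\<close>

definition graph_dist :: "'a pair_pre_digraph \<Rightarrow> 'a \<Rightarrow> 'a \<Rightarrow> ereal" where
  "graph_dist G u v = wf_digraph.\<mu> (with_proj G) (\<lambda>_. 1) u v"

definition graph_power :: "'a pair_pre_digraph \<Rightarrow> nat \<Rightarrow> 'a pair_pre_digraph" where
  "graph_power H m = \<lparr> pverts = pverts H,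
     parcs = {(x, y). x \<in> pverts H \<and> y \<in> pverts H \<and> x \<noteq> y \<and>
                1 \<le> graph_dist H x y \<and> graph_dist H x y \<le> ereal (real m)} \<rparr>"

text \<open>
  For \<open>0 \<le> i \<le> n\<close>, \<open>subdiv_point n u v i\<close> is the vertex at distance \<open>i\<close> from \<open>u\<close> on the path of
  length \<open>n\<close> that replaces the edge \<open>uv\<close>. Read from the other end it is the vertex at distance
  \<open>n - i\<close> from \<open>v\<close>, so an inner vertex is named by the unordered pair of its two descriptions.
\<close>

datatype 'a subdiv_vertex = Original 'a | Inner "('a \<times> 'a \<times> nat) set"

definition subdiv_point :: "nat \<Rightarrow> 'a \<Rightarrow> 'a \<Rightarrow> nat \<Rightarrow> 'a subdiv_vertex" where
  "subdiv_point n u v i =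
     (if i = 0 then Original u
      else if i = n then Original v
      else Inner {(u, v, i), (v, u, n - i)})"

text \<open>Meaningful for \<open>n \<ge> 1\<close>. Opposite arcs of \<open>G\<close> yield opposite arcs of the same path, by the
  lemma \<open>subdiv_point_swap\<close> below.\<close>

definition n_subdivision :: "'a pair_pre_digraph \<Rightarrow> nat \<Rightarrow> 'a subdiv_vertex pair_pre_digraph" where
  "n_subdivision G n = \<lparr>
     pverts = Original ` pverts G \<union> {subdiv_point n u v i |u v i. (u, v) \<in> parcs G \<and> 0 < i \<and> i < n},
     parcs = {(subdiv_point n u v i, subdiv_point n u v (Suc i)) |u v i. (u, v) \<in> parcs G \<and> i < n} \<rparr>"

text \<open>The fraction \<open>m/n\<close> is not reduced.\<close>

definition fractional_power :: "'a pair_pre_digraph \<Rightarrow> nat \<Rightarrow> nat \<Rightarrow> 'a subdiv_vertex pair_pre_digraph" where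
  "fractional_power G m n = graph_power (n_subdivision G n) m"

lemma subdiv_point_swap:
  assumes "0 < n" "i \<le> n"
  shows "subdiv_point n v u (n - i) = subdiv_point n u v i"
  using assms by (auto simp: subdiv_point_def)

lemma subdiv_point_eq_iff:
  assumes "0 < i" "i < n" "0 < j" "j < n"
  shows "subdiv_point n u v i = subdiv_point n u' v' j \<longleftrightarrow>
    u' = u \<and> v' = v \<and> j = i \<or> u' = v \<and> v' = u \<and> j = n - i"
  using assms by (auto simp: subdiv_point_def doubleton_eq_iff)

lemma pair_graph_n_subdivision:
  assumes "pair_graph G" "0 < n"
  shows "pair_graph (n_subdivision G n)"
proof -
  interpret pair_graph G by fact
  have fin: "finite (parcs G)" "finite (pverts G)" by (rule pair_finite_arcs pair_finite_verts)+
  let ?H = "n_subdivision G n"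
  have mem: "subdiv_point n u v i \<in> pverts ?H" if "(u, v) \<in> parcs G" "i \<le> n" for u v i
  proof (cases "0 < i \<and> i < n")
    case True
    then show ?thesis using that(1) by (auto simp: n_subdivision_def)
  next
    case False
    then have "i = 0 \<or> i = n" using that(2) by auto
    then show ?thesis
      using in_arcsD1[OF that(1)] in_arcsD2[OF that(1)] assms(2)
      by (auto simp: n_subdivision_def subdiv_point_def)
  qed
  have "{subdiv_point n u v i |u v i. (u, v) \<in> parcs G \<and> 0 < i \<and> i < n}
      \<subseteq> (\<lambda>((u, v), i). subdiv_point n u v i) ` (parcs G \<times> {..<n})" by force
  then have "finite {subdiv_point n u v i |u v i. (u, v) \<in> parcs G \<and> 0 < i \<and> i < n}"
    by (rule finite_subset) (use fin in simp)
  then have finV: "finite (pverts ?H)"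
    using fin by (simp add: n_subdivision_def)
  have "parcs ?H \<subseteq>
      (\<lambda>((u, v), i). (subdiv_point n u v i, subdiv_point n u v (Suc i))) ` (parcs G \<times> {..<n})"
    by (force simp: n_subdivision_def)
  then have finA: "finite (parcs ?H)"
    by (rule finite_subset) (use fin in simp)
  have ends: "fst e \<in> pverts ?H \<and> snd e \<in> pverts ?H" if e: "e \<in> parcs ?H" for e
  proof -
    obtain u v i where "e = (subdiv_point n u v i, subdiv_point n u v (Suc i))" "(u, v) \<in> parcs G" "i < n"
      using e by (auto simp: n_subdivision_def)
    then show ?thesis using mem by auto
  qed
  have noloop: "fst e \<noteq> snd e" if e: "e \<in> parcs ?H" for e
  proof -
    obtain u v i where *: "e = (subdiv_point n u v i, subdiv_point n u v (Suc i))" "(u, v) \<in> parcs G" "i < n"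
      using e by (auto simp: n_subdivision_def)
    have "u \<noteq> v" using pair_no_loops[OF *(2)] by simp
    then show ?thesis using *(1,3) by (auto simp: subdiv_point_def doubleton_eq_iff)
  qed
  have rev: "(y, x) \<in> parcs ?H" if xy: "(x, y) \<in> parcs ?H" for x y
  proof -
    obtain u v i where *: "x = subdiv_point n u v i" "y = subdiv_point n u v (Suc i)"
      "(u, v) \<in> parcs G" "i < n"
      using xy by (auto simp: n_subdivision_def)
    have "(v, u) \<in> parcs G"
      using pair_sym_arcs *(3) by (auto simp: symmetric_def sym_def)
    moreover have "y = subdiv_point n v u (n - Suc i)" "x = subdiv_point n v u (Suc (n - Suc i))"
      using * assms(2) subdiv_point_swap[of n "Suc i" v u] subdiv_point_swap[of n i v u]
      by (simp_all add: Suc_diff_Suc)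
    moreover have "n - Suc i < n" using assms(2) by simp
    ultimately show ?thesis
      unfolding n_subdivision_def by simp blast
  qed
  show ?thesis
    by unfold_locales (use ends noloop rev finV finA in \<open>auto simp: symmetric_def sym_def\<close>)
qed

end

theory Submission
  imports Defs
begin

text \<open>
  A vertex of maximum degree together with the neighbouring inner vertices is a clique of size
  \<open>\<Delta> + 1\<close> in the square, so the point is to color the square with \<open>\<Delta> + 1\<close> colors.
  First color the original vertices and the half-edges, that is, the inner vertices
  next to an original vertex; then fill in each path separately. A coloring of the square of a
  path of length \<open>n \<ge> 2\<close> extends to length \<open>n + 3\<close> without changing the two colors at each end,
  by repeating its first three colors, so only the lengths 3, 4 and 5 matter.
  For the lengths 3 and 4 all original vertices get one color, and the half-edges get the other
  \<open>\<Delta>\<close> colors such that the two half-edges of an edge differ; this amounts to a \<open>\<Delta>\<close>-edge-coloring of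
  the bipartite graph \<open>G\<^sup>1\<^sup>/\<^sup>2\<close>, which exists by Koenig's theorem (Kempe swaps).
  For length 5 a greedy proper coloring of \<open>G\<close> with \<open>\<Delta> + 1\<close> colors is used at the original vertices, and any
  locally injective coloring of the half-edges will do.
\<close>

lemma ex_color_notin:
  assumes "finite S" "card S < k"
  shows "\<exists>x<k. x \<notin> (S :: nat set)"
proof (rule ccontr)
  assume "\<not> ?thesis"
  then have "{..<k} \<subseteq> S" by auto
  from card_mono[OF assms(1) this] assms(2) show False by simp
qed

subsection \<open>Coloring half-edges\<close>

text \<open>\<open>h u v\<close> is the color of the half of the edge \<open>uv\<close> at \<open>u\<close>.\<close>

definition halfedge_coloring :: "'a rel \<Rightarrow> nat \<Rightarrow> ('a \<Rightarrow> 'a \<Rightarrow> nat) \<Rightarrow> bool" where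
  "halfedge_coloring E k h \<longleftrightarrow>
     (\<forall>u v. (u, v) \<in> E \<longrightarrow> h u v < k \<and> h u v \<noteq> h v u) \<and> (\<forall>u. inj_on (h u) (E `` {u}))"

text \<open>The half-edges on the path that starts at \<open>u\<close> and whose colors alternate between \<open>b\<close> and \<open>a\<close>.\<close>

inductive_set kempe_path :: "'a rel \<Rightarrow> ('a \<Rightarrow> 'a \<Rightarrow> nat) \<Rightarrow> nat \<Rightarrow> nat \<Rightarrow> 'a \<Rightarrow> 'a rel"
  for E h a b u where
  start: "(u, w) \<in> E \<Longrightarrow> h u w = b \<Longrightarrow> (u, w) \<in> kempe_path E h a b u"
| cross: "(x, y) \<in> kempe_path E h a b u \<Longrightarrow> h x y = b \<Longrightarrow> h y x = a
    \<Longrightarrow> (y, x) \<in> kempe_path E h a b u"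
| turn: "(x, y) \<in> kempe_path E h a b u \<Longrightarrow> h x y = a \<Longrightarrow> (x, z) \<in> E \<Longrightarrow> h x z = b
    \<Longrightarrow> (x, z) \<in> kempe_path E h a b u"

text \<open>An inversion that remembers how the path got to \<open>x\<close>: it starts there or
  came in on an \<open>a\<close>-colored half-edge at \<open>x\<close>. An \<open>a\<close>-colored
  member is always reached from the opposite half of its edge.\<close>

lemma kempe_path_cases:
  assumes "(x, y) \<in> kempe_path E h a b u" "sym E"
  shows "(x, y) \<in> E \<and>
    (h x y = b \<and> (x = u \<or> (\<exists>z. (x, z) \<in> kempe_path E h a b u \<and> (x, z) \<in> E \<and> h x z = a)) \<or>
     h x y = a \<and> (y, x) \<in> kempe_path E h a b u \<and> h y x = b)"
  using assms(1)
proof induction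
  case (turn x y z)
  then show ?case by blast
qed (use assms(2) in \<open>auto dest: symD\<close>)

text \<open>The path enters a vertex only along a half-edge of color \<open>a\<close>, so it never reaches a vertex \<open>v\<close> that
  misses \<open>a\<close>, and swapping the colors along it does not change the half-edges at \<open>v\<close>.\<close>

lemma kempe_swap:
  assumes E: "sym E" and h: "halfedge_coloring E k h"
    and col: "a < k" "b < k" "a \<noteq> b" and "u \<noteq> v"
    and u: "\<And>w. (u, w) \<in> E \<Longrightarrow> h u w \<noteq> a" and v: "\<And>w. (v, w) \<in> E \<Longrightarrow> h v w \<noteq> a"
  shows "\<exists>h'. halfedge_coloring E k h' \<and>
    (\<forall>w. (u, w) \<in> E \<longrightarrow> h' u w \<noteq> b) \<and> (\<forall>w. (v, w) \<in> E \<longrightarrow> h' v w \<noteq> a)"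
proof -
  define P where "P = kempe_path E h a b u"
  define h' where "h' x y = (if (x, y) \<in> P then if h x y = a then b else a else h x y)" for x y
  have symE: "(y, x) \<in> E" if "(x, y) \<in> E" for x y using E that by (auto dest: symD)
  have hk: "h x y < k" "h x y \<noteq> h y x" if "(x, y) \<in> E" for x y
    using h that by (auto simp: halfedge_coloring_def)
  have hinj: "y = z" if "(x, y) \<in> E" "(x, z) \<in> E" "h x y = h x z" for x y z
    using h that by (auto simp: halfedge_coloring_def inj_on_def)
  have P: "(x, y) \<in> E \<and>
      (h x y = b \<and> (x = u \<or> (\<exists>z. (x, z) \<in> P \<and> (x, z) \<in> E \<and> h x z = a)) \<or>
       h x y = a \<and> (y, x) \<in> P \<and> h y x = b)" if "(x, y) \<in> P" for x y
    using kempe_path_cases[OF _ E] that unfolding P_def by blast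
  \<comment> \<open>\<open>opp\<close> and \<open>fan\<close>: among the half-edges colored
    \<open>a\<close> or \<open>b\<close>, \<open>P\<close> is closed under passing to the other half
    of the edge or to another half-edge at the same vertex. Hence two half-edges with these colors
    that must differ are both swapped or both kept.\<close>
  have opp: "(y, x) \<in> P" if "(x, y) \<in> P" "h y x = a \<or> h y x = b" for x y
    using P[OF that(1)] that hk(2)[of x y] kempe_path.cross[of x y E h a b u]
    unfolding P_def by metis
  have fan: "(x, z) \<in> P" if "(x, y) \<in> P" "(x, z) \<in> E" "h x z = a \<or> h x z = b" for x y z
  proof (cases "h x y = h x z")
    case True
    then show ?thesis using hinj P that by metis
  next
    case False
    show ?thesis
    proof (cases "h x y = a")
      case True
      then show ?thesis using kempe_path.turn[of x y E h a b u z] that False unfolding P_def by auto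
    next
      case False
      then have "h x y = b" "h x z = a" using P[OF that(1)] that \<open>h x y \<noteq> h x z\<close> by auto
      \<comment> \<open>\<open>x\<close> is not \<open>u\<close>, which misses \<open>a\<close>, so
        the path entered \<open>x\<close> on an \<open>a\<close>-colored half-edge; by injectivity
        this is \<open>(x, z)\<close>.\<close>
      then show ?thesis using P[OF that(1)] that(2) u hinj col(3) by metis
    qed
  qed
  have "h' x y < k \<and> h' x y \<noteq> h' y x" if "(x, y) \<in> E" for x y
    using hk[OF that] P[of x y] P[of y x] opp[of x y] opp[of y x] col
    unfolding h'_def by (smt (verit))
  moreover have "inj_on (h' x) (E `` {x})" for x
  proof (rule inj_onI)
    fix y z assume "y \<in> E `` {x}" "z \<in> E `` {x}" "h' x y = h' x z"
    then show "y = z"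
      using hinj[of x y z] P[of x y] P[of x z] fan[of x y z] fan[of x z y] col(3)
      unfolding h'_def by (smt (verit) Image_singleton_iff)
  qed
  moreover have "h' u w \<noteq> b" if "(u, w) \<in> E" for w
    using kempe_path.start[of u w E h b a] u[OF that] that col(3)
    unfolding h'_def P_def by auto
  moreover have "h' v w \<noteq> a" if "(v, w) \<in> E" for w
  proof -
    have "(v, w) \<notin> P" using P[of v w] v \<open>u \<noteq> v\<close> by blast
    then show ?thesis using v[OF that] by (simp add: h'_def)
  qed
  ultimately show ?thesis unfolding halfedge_coloring_def by blast
qed

text \<open>Induction on the number of arcs: delete both arcs of one edge. Its ends then have degree
  below \<open>k\<close>, so each misses a color, and the edge can be put back as soon as the two
  missing colors differ.\<close>

theorem ex_halfedge_coloring: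
  fixes E :: "'a rel"
  assumes "finite E" "sym E" "irrefl E" "\<And>u. card (E `` {u}) \<le> k" "2 \<le> k"
  shows "\<exists>h. halfedge_coloring E k h"
  using assms(1-4)
proof (induction "card E" arbitrary: E rule: less_induct)
  case less
  show ?case
  proof (cases "E = {}")
    case True
    then show ?thesis by (auto simp: halfedge_coloring_def)
  next
    case False
    then obtain u v where uv: "(u, v) \<in> E" by auto
    then have vu: "(v, u) \<in> E" and "u \<noteq> v" using less.prems by (auto simp: sym_def irrefl_def)
    define E' where "E' = E - {(u, v), (v, u)}"
    have sub: "E' \<subseteq> E" and fin: "finite E'" using less.prems by (auto simp: E'_def)
    have E': "sym E'" "irrefl E'" using less.prems by (auto simp: E'_def sym_def irrefl_def)
    have finI: "finite (F `` {x})" if "finite F" for F :: "'a rel" and x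
      using that by (simp add: finite_Image)
    have deg': "card (E' `` {x}) \<le> card (E `` {x})" for x
      using sub finI[OF less.prems(1)] by (intro card_mono) auto
    have "E' \<subset> E" using uv by (auto simp: E'_def)
    then have "card E' < card E" using less.prems(1) by (rule psubset_card_mono[rotated])
    then obtain h where h: "halfedge_coloring E' k h"
      using less.hyps[of E'] fin E' deg' less.prems(4) le_trans by meson
    have miss: "\<exists>a<k. \<forall>w. (x, w) \<in> E' \<longrightarrow> h x w \<noteq> a" if "x = u \<or> x = v" for x
    proof -
      have "E' `` {x} \<subset> E `` {x}" using uv vu that by (auto simp: E'_def)
      then have "card (E' `` {x}) < card (E `` {x})"
        using finI[OF less.prems(1)] by (rule psubset_card_mono[rotated])
      then have "card (h x ` (E' `` {x})) < k"
        using card_image_le[OF finI[OF fin], of "h x" x] less.prems(4)[of x] by linarith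
      then obtain a where "a < k" "a \<notin> h x ` (E' `` {x})"
        using ex_color_notin finI[OF fin] by blast
      then show ?thesis by blast
    qed
    obtain a where a: "a < k" "\<And>w. (u, w) \<in> E' \<Longrightarrow> h u w \<noteq> a" using miss[of u] by blast
    obtain b where b: "b < k" "\<And>w. (v, w) \<in> E' \<Longrightarrow> h v w \<noteq> b" using miss[of v] by blast
    have "\<exists>h a b. halfedge_coloring E' k h \<and> a < k \<and> b < k \<and> a \<noteq> b \<and>
        (\<forall>w. (u, w) \<in> E' \<longrightarrow> h u w \<noteq> a) \<and> (\<forall>w. (v, w) \<in> E' \<longrightarrow> h v w \<noteq> b)"
    proof (cases "a = b")
      case False
      then show ?thesis using h a b by blast
    next
      case True
      \<comment> \<open>Both ends miss \<open>a\<close>. Swapping \<open>a\<close> and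
        \<open>c\<close> along the path from \<open>u\<close> makes \<open>u\<close> miss
        \<open>c\<close>, while \<open>v\<close> still misses \<open>a\<close>.\<close>
      obtain c where c: "c < k" "c \<noteq> a" using ex_color_notin[of "{a}" k] \<open>2 \<le> k\<close> by auto
      then show ?thesis
        using kempe_swap[OF E'(1) h a(1) c(1) c(2)[symmetric] \<open>u \<noteq> v\<close>] a b True by blast
    qed
    then obtain h a b where h: "halfedge_coloring E' k h" and ab: "a < k" "b < k" "a \<noteq> b"
      and u: "\<And>w. (u, w) \<in> E' \<Longrightarrow> h u w \<noteq> a" and v: "\<And>w. (v, w) \<in> E' \<Longrightarrow> h v w \<noteq> b"
      by blast
    define g where
      "g x y = (if (x, y) = (u, v) then a else if (x, y) = (v, u) then b else h x y)" for x y
    have E_cases: "(x, y) = (u, v) \<or> (x, y) = (v, u) \<or> (x, y) \<in> E'" if "(x, y) \<in> E" for x y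
      using that by (auto simp: E'_def)
    have g: "g u v = a" "g v u = b" using \<open>u \<noteq> v\<close> by (auto simp: g_def)
    have gh: "g x y = h x y" "g y x = h y x" if "(x, y) \<in> E'" for x y
    proof -
      have "(x, y) \<noteq> (u, v)" "(x, y) \<noteq> (v, u)" "(y, x) \<noteq> (u, v)" "(y, x) \<noteq> (v, u)"
        using that unfolding E'_def by blast+
      then show "g x y = h x y" "g y x = h y x" by (simp_all only: g_def if_False)
    qed
    have hk: "h x y < k" "h x y \<noteq> h y x" if "(x, y) \<in> E'" for x y
      using h that by (auto simp: halfedge_coloring_def)
    have hinj: "y = z" if "(x, y) \<in> E'" "(x, z) \<in> E'" "h x y = h x z" for x y z
      using h that by (auto simp: halfedge_coloring_def inj_on_def)
    have "halfedge_coloring E k g"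
      unfolding halfedge_coloring_def
    proof (intro conjI allI impI inj_onI)
      fix x y assume "(x, y) \<in> E"
      note cases = E_cases[OF this]
      show "g x y < k" using cases g gh(1)[of x y] hk(1)[of x y] ab by (metis prod.inject)
      show "g x y \<noteq> g y x" using cases g gh[of x y] hk(2)[of x y] ab by (metis prod.inject)
    next
      fix x y z assume "y \<in> E `` {x}" "z \<in> E `` {x}" and eq: "g x y = g x z"
      then have "(x, y) \<in> E" "(x, z) \<in> E" by auto
      from E_cases[OF this(1)] E_cases[OF this(2)] show "y = z"
        using eq g gh(1)[of x y] gh(1)[of x z] hinj[of x y z] u[of y] u[of z] v[of y] v[of z] \<open>u \<noteq> v\<close>
        by (smt (verit) prod.inject)
    qed
    then show ?thesis by blast
  qed
qed

text \<open>Vertices are colored one at a time; at most \<open>k\<close> neighbors block at most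
  \<open>k\<close> of the \<open>k + 1\<close> colors.\<close>

lemma greedy_coloring:
  assumes "finite V" "finite E" "sym E" "irrefl E" "\<And>u. card (E `` {u}) \<le> k"
  shows "\<exists>c :: 'a \<Rightarrow> nat. (\<forall>u\<in>V. c u \<le> k) \<and> (\<forall>u\<in>V. \<forall>v\<in>V. (u, v) \<in> E \<longrightarrow> c u \<noteq> c v)"
  using assms(1)
proof (induction V)
  case (insert x V)
  then obtain c where c: "\<forall>u\<in>V. c u \<le> k" "\<forall>u\<in>V. \<forall>v\<in>V. (u, v) \<in> E \<longrightarrow> c u \<noteq> c v" by blast
  have fin: "finite (E `` {x})" using assms(2) by (simp add: finite_Image)
  have "card (c ` (E `` {x})) < Suc k"
    using card_image_le[OF fin, of c] assms(5)[of x] by linarith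
  then obtain a where "a < Suc k" "a \<notin> c ` (E `` {x})"
    using ex_color_notin fin by blast
  then have "(\<forall>u\<in>insert x V. (c(x := a)) u \<le> k) \<and>
      (\<forall>u\<in>insert x V. \<forall>v\<in>insert x V. (u, v) \<in> E \<longrightarrow> (c(x := a)) u \<noteq> (c(x := a)) v)"
    using c assms(3,4) insert.hyps(2) by (auto simp: sym_def irrefl_def)
  then show ?case by blast
qed simp

subsection \<open>Filling in the paths\<close>

text \<open>The palette \<open>0\<close> to \<open>k\<close> has \<open>k + 1\<close> colors;
  \<open>k\<close> will be the maximum degree.\<close>

definition path_square_coloring :: "nat \<Rightarrow> nat \<Rightarrow> (nat \<Rightarrow> nat) \<Rightarrow> bool" where
  "path_square_coloring n k q \<longleftrightarrow> (\<forall>i\<le>n. q i \<le> k) \<and>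
     (\<forall>i<n. q i \<noteq> q (Suc i)) \<and> (\<forall>i. i + 2 \<le> n \<longrightarrow> q i \<noteq> q (i + 2))"

lemma path_square_coloring_rev:
  assumes "path_square_coloring n k q"
  shows "path_square_coloring n k (\<lambda>i. q (n - i))"
  unfolding path_square_coloring_def
proof (intro conjI allI impI)
  fix i assume "i < n"
  then have "n - i = Suc (n - Suc i)" "n - Suc i < n" by simp_all
  then show "q (n - i) \<noteq> q (n - Suc i)"
    using assms unfolding path_square_coloring_def by metis
next
  fix i assume "i + 2 \<le> n"
  then have "n - i = (n - (i + 2)) + 2" "(n - (i + 2)) + 2 \<le> n" by simp_all
  then show "q (n - i) \<noteq> q (n - (i + 2))"
    using assms unfolding path_square_coloring_def by metis
qed (use assms in \<open>simp add: path_square_coloring_def\<close>)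

text \<open>The new sequence is \<open>q 0, q 1, q 2, q 0, q 1, q 2, ...\<close>. Three consecutive
  entries are a window of \<open>q\<close> or a rotation of its first three colors, which are
  distinct because \<open>2 \<le> n\<close>.\<close>

lemma path_square_coloring_extend:
  assumes "path_square_coloring n k q" "2 \<le> n"
  shows "path_square_coloring (n + 3) k (\<lambda>i. if i < 3 then q i else q (i - 3))"
proof -
  have q: "\<And>i. i \<le> n \<Longrightarrow> q i \<le> k" "\<And>i. i < n \<Longrightarrow> q i \<noteq> q (Suc i)"
    "\<And>i. i + 2 \<le> n \<Longrightarrow> q i \<noteq> q (i + 2)"
    using assms by (auto simp: path_square_coloring_def)
  have small: "q 0 \<noteq> q (Suc 0)" "q (Suc 0) \<noteq> q (Suc (Suc 0))" "q 0 \<noteq> q (Suc (Suc 0))"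
    using q(2)[of 0] q(2)[of 1] q(3)[of 0] assms(2) by (simp_all add: eval_nat_numeral)
  have lt: "i = 0 \<or> i = 1 \<or> i = 2 \<or> (\<exists>j. i = j + 3)" for i :: nat by presburger
  show ?thesis
    unfolding path_square_coloring_def
  proof (intro conjI allI impI)
    fix i assume "i \<le> n + 3"
    then show "(if i < 3 then q i else q (i - 3)) \<le> k" using q(1) assms(2) by auto
  next
    fix i assume "i < n + 3"
    then show "(if i < 3 then q i else q (i - 3)) \<noteq> (if Suc i < 3 then q (Suc i) else q (Suc i - 3))"
      using lt[of i] small q(2) by (auto simp: eval_nat_numeral)
  next
    fix i assume "i + 2 \<le> n + 3"
    then show "(if i < 3 then q i else q (i - 3)) \<noteq> (if i + 2 < 3 then q (i + 2) else q (i + 2 - 3))"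
      using lt[of i] small q(3) by (auto simp: eval_nat_numeral)
  qed
qed

text \<open>\<open>s\<close> and \<open>t\<close> are the colors of the two original vertices,
  \<alpha> and \<beta> those of the half-edges next to them.\<close>

definition fits_ends :: "nat \<Rightarrow> nat \<Rightarrow> nat \<Rightarrow> nat \<Rightarrow> nat \<Rightarrow> (nat \<Rightarrow> nat) \<Rightarrow> bool" where
  "fits_ends n s \<alpha> \<beta> t q \<longleftrightarrow> q 0 = s \<and> q 1 = \<alpha> \<and> q (n - 1) = \<beta> \<and> q n = t"

lemma path_square_coloring_lists:
  "path_square_coloring 3 k (\<lambda>i. [p, q, r, s] ! i) \<longleftrightarrow>
     {p, q, r, s} \<subseteq> {..k} \<and> distinct [p, q, r] \<and> distinct [q, r, s]"
  "path_square_coloring 4 k (\<lambda>i. [p, q, r, s, t] ! i) \<longleftrightarrow>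
     {p, q, r, s, t} \<subseteq> {..k} \<and> distinct [p, q, r] \<and> distinct [q, r, s] \<and> distinct [r, s, t]"
  "path_square_coloring 5 k (\<lambda>i. [p, q, r, s, t, w] ! i) \<longleftrightarrow>
     {p, q, r, s, t, w} \<subseteq> {..k} \<and> distinct [p, q, r] \<and> distinct [q, r, s] \<and> distinct [r, s, t] \<and>
       distinct [s, t, w]"
proof -
  \<comment> \<open>All bounds are brought to the form \<open>i < m\<close>, so that
    \<open>All_less_Suc\<close> unrolls the quantifiers.\<close>
  have *: "path_square_coloring n k f \<longleftrightarrow> (\<forall>i<Suc n. f i \<le> k) \<and>
      (\<forall>i<n. f i \<noteq> f (Suc i)) \<and> (\<forall>i<n - 1. f i \<noteq> f (Suc (Suc i)))" for n f
    unfolding path_square_coloring_def less_Suc_eq_le less_diff_conv Suc_le_eq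
    by (simp add: Suc_le_eq)
  note [simp] = * All_less_Suc eval_nat_numeral
  show "path_square_coloring 3 k (\<lambda>i. [p, q, r, s] ! i) \<longleftrightarrow>
     {p, q, r, s} \<subseteq> {..k} \<and> distinct [p, q, r] \<and> distinct [q, r, s]"
    by simp blast
  show "path_square_coloring 4 k (\<lambda>i. [p, q, r, s, t] ! i) \<longleftrightarrow>
     {p, q, r, s, t} \<subseteq> {..k} \<and> distinct [p, q, r] \<and> distinct [q, r, s] \<and> distinct [r, s, t]"
    by simp blast
  show "path_square_coloring 5 k (\<lambda>i. [p, q, r, s, t, w] ! i) \<longleftrightarrow>
     {p, q, r, s, t, w} \<subseteq> {..k} \<and> distinct [p, q, r] \<and> distinct [q, r, s] \<and> distinct [r, s, t] \<and>
       distinct [s, t, w]"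
    by simp blast
qed

text \<open>Induction in steps of three, so \<open>n mod 3\<close> determines the base length.
  Length 3 leaves no freedom: it needs \<open>\<alpha> \<noteq> \<beta>\<close>, and
  \<open>s = t\<close> turns its other two conditions, \<open>s \<noteq> \<beta>\<close> and
  \<open>\<alpha> \<noteq> t\<close>, into \<open>ne\<close>. Length 5 has two free positions and
  tolerates \<open>\<alpha> = \<beta>\<close>.\<close>

lemma ex_path_square_coloring:
  assumes "3 \<le> n" "3 \<le> k" and le: "s \<le> k" "\<alpha> \<le> k" "\<beta> \<le> k" "t \<le> k" and ne: "\<alpha> \<noteq> s" "\<beta> \<noteq> t"
    and mod: "if n mod 3 = 2 then s \<noteq> t else s = t \<and> \<alpha> \<noteq> \<beta>"
  shows "\<exists>q. path_square_coloring n k q \<and> fits_ends n s \<alpha> \<beta> t q"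
  using assms(1) mod
proof (induction n rule: less_induct)
  case (less n)
  \<comment> \<open>There are at least four colors, so any three can be avoided.\<close>
  have pick: "\<exists>x\<le>k. x \<noteq> p \<and> x \<noteq> q \<and> x \<noteq> r" for p q r
  proof -
    have "card {p, q, r} \<le> 3" by (auto simp: card_insert_if)
    then have "card {p, q, r} < Suc k" using assms(2) by linarith
    moreover have "finite {p, q, r}" by simp
    ultimately obtain x where "x < Suc k" "x \<notin> {p, q, r}"
      by (meson ex_color_notin)
    then show ?thesis by (intro exI[of _ x]) simp
  qed
  consider "n = 3" | "n = 4" | "n = 5" | "n \<ge> 6" using less.prems(1) by arith
  then show ?case
  proof cases
    case 1
    then show ?thesis using less.prems le ne
      by (intro exI[of _ "\<lambda>i. [s, \<alpha>, \<beta>, t] ! i"])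
        (auto simp: path_square_coloring_lists fits_ends_def)
  next
    case 2
    obtain x where "x \<le> k" "x \<noteq> s" "x \<noteq> \<alpha>" "x \<noteq> \<beta>" using pick by blast
    with 2 show ?thesis using less.prems le ne
      by (intro exI[of _ "\<lambda>i. [s, \<alpha>, x, \<beta>, t] ! i"])
        (auto simp: path_square_coloring_lists fits_ends_def)
  next
    case 3
    then have "s \<noteq> t" using less.prems by simp
    have "\<exists>x y. x \<le> k \<and> y \<le> k \<and> x \<notin> {s, \<alpha>, \<beta>, y} \<and> y \<notin> {\<alpha>, \<beta>, t}"
    proof (cases "s = \<beta>")
      case True
      \<comment> \<open>As \<open>s = \<beta>\<close>, both \<open>y\<close> and then
        \<open>x\<close> have only three colors to avoid.\<close>
      obtain y where "y \<le> k" "y \<noteq> \<alpha>" "y \<noteq> s" "y \<noteq> t" using pick by blast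
      moreover obtain x where "x \<le> k" "x \<noteq> \<alpha>" "x \<noteq> s" "x \<noteq> y" using pick by blast
      ultimately show ?thesis using True by blast
    next
      case False
      obtain x where "x \<le> k" "x \<noteq> \<alpha>" "x \<noteq> s" "x \<noteq> \<beta>" using pick by blast
      \<comment> \<open>The witness for \<open>y\<close> is \<open>s\<close> itself, which differs
        from \<alpha>, \<beta>, \<open>t\<close> and \<open>x\<close>.\<close>
      then show ?thesis using False \<open>s \<noteq> t\<close> le ne by blast
    qed
    then obtain x y where "x \<le> k" "y \<le> k" "x \<notin> {s, \<alpha>, \<beta>, y}" "y \<notin> {\<alpha>, \<beta>, t}" by blast
    with 3 show ?thesis using le ne
      by (intro exI[of _ "\<lambda>i. [s, \<alpha>, x, y, \<beta>, t] ! i"])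
        (auto simp: path_square_coloring_lists fits_ends_def)
  next
    case 4
    then obtain m where m: "n = m + 3" "3 \<le> m"
      using that[of "n - 3"] by simp
    then obtain q where "path_square_coloring m k q" "fits_ends m s \<alpha> \<beta> t q"
      using less.IH[of m] less.prems by auto
    then show ?thesis
      using path_square_coloring_extend[of m k q] m
      by (intro exI[of _ "\<lambda>i. if i < 3 then q i else q (i - 3)"]) (auto simp: fits_ends_def)
  qed
qed

subsection \<open>Squares of graphs\<close>

lemma (in pair_wf_digraph) awalk_cost_const_1: "awalk_cost (\<lambda>_. 1) p = real (length p)"
  by (induction p) (auto simp: awalk_cost_def)

lemma (in pair_wf_digraph) graph_dist_le_2_iff:
  "graph_dist G x y \<le> 2 \<longleftrightarrow> (\<exists>p. awalk x p y \<and> length p \<le> 2)"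
proof -
  have dist: "graph_dist G x y = (INF p\<in>{p. awalk x p y}. ereal (real (length p)))"
    by (simp add: graph_dist_def \<mu>_def awalk_cost_const_1)
  show ?thesis
  proof
    assume "graph_dist G x y \<le> 2"
    \<comment> \<open>A strict bound on the infimum yields an actual walk; its length is an integer
      below 3, hence at most 2.\<close>
    also have "(2 :: ereal) < 3" by simp
    finally obtain p where "awalk x p y" "ereal (real (length p)) < 3"
      unfolding dist INF_less_iff by auto
    then show "\<exists>p. awalk x p y \<and> length p \<le> 2" by (intro exI[of _ p]) auto
  next
    assume "\<exists>p. awalk x p y \<and> length p \<le> 2"
    then obtain p where p: "awalk x p y" "length p \<le> 2" by blast
    have "graph_dist G x y \<le> ereal (real (length p))"
      unfolding dist using p(1) by (intro INF_lower) simp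
    also have "\<dots> \<le> 2" using p(2) by simp
    finally show "graph_dist G x y \<le> 2" .
  qed
qed

lemma (in pair_wf_digraph) graph_dist_ge_1:
  assumes "x \<noteq> y"
  shows "1 \<le> graph_dist G x y"
proof -
  show ?thesis
    unfolding graph_dist_def \<mu>_def awalk_cost_const_1
  proof (rule INF_greatest)
    fix p assume "p \<in> {p. awalk x p y}"
    then have "p \<noteq> []" using assms by (auto simp: awalk_Nil_iff)
    then show "1 \<le> ereal (real (length p))" by (cases p) (auto simp: one_ereal_def)
  qed
qed

lemma (in pair_wf_digraph) in_parcs_graph_square_iff:
  "(x, y) \<in> parcs (graph_power G 2) \<longleftrightarrow>
     x \<noteq> y \<and> ((x, y) \<in> parcs G \<or> (\<exists>z. (x, z) \<in> parcs G \<and> (z, y) \<in> parcs G))" (is "?L \<longleftrightarrow> ?R")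
proof
  assume ?L
  then have "x \<noteq> y" "graph_dist G x y \<le> 2" by (auto simp: graph_power_def)
  then obtain p where "awalk x p y" "length p \<le> 2" using graph_dist_le_2_iff by blast
  then show ?R using \<open>x \<noteq> y\<close>
    by (cases p; cases "tl p") (auto simp: awalk_simps)
next
  assume R: ?R
  then have "\<exists>p. awalk x p y \<and> length p \<le> 2"
  proof (elim conjE disjE exE)
    assume "(x, y) \<in> parcs G"
    then show ?thesis by (intro exI[of _ "[(x, y)]"]) (auto simp: awalk_simps dest: in_arcsD2)
  next
    fix z assume "(x, z) \<in> parcs G" "(z, y) \<in> parcs G"
    then show ?thesis
      by (intro exI[of _ "[(x, z), (z, y)]"]) (auto simp: awalk_simps dest: in_arcsD2)
  qed
  then show ?L
    using R graph_dist_le_2_iff graph_dist_ge_1 by (auto simp: graph_power_def dest: in_arcsD1 in_arcsD2)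
qed

section \<open>Cliques as lower bounds for colorings\<close>

lemma card_clique_le:
  assumes "proper_coloring G k c" "clique G S"
  shows "card S \<le> k"
proof -
  have "inj_on c S" using assms unfolding inj_on_def proper_coloring_def clique_def by blast
  moreover have "c ` S \<subseteq> {..<k}" using assms by (auto simp: proper_coloring_def clique_def)
  ultimately show ?thesis using card_inj_on_le[of c S "{..<k}"] by simp
qed

lemma chromatic_and_clique_number_eqI:
  assumes "finite (pverts G)" "proper_coloring G k c" "clique G S" "card S = k"
  shows "chromatic_number G = k" "clique_number G = k"
proof -
  show "chromatic_number G = k"
    unfolding chromatic_number_def
    using assms(2-4) card_clique_le by (intro Least_equality) blast+
  have "finite {S. clique G S}"
    by (rule finite_subset[of _ "Pow (pverts G)"]) (use assms(1) in \<open>auto simp: clique_def\<close>)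
  then show "clique_number G = k"
    unfolding clique_number_def
    using assms card_clique_le[OF assms(2)] by (intro Max_eqI) auto
qed

lemma out_degree_with_proj:
  "out_degree (with_proj G) u = card (parcs G `` {u})"
proof -
  have "out_arcs (with_proj G) u = Pair u ` (parcs G `` {u})" by (auto simp: out_arcs_def)
  then show ?thesis by (simp add: out_degree_def card_image inj_on_def)
qed

subsection \<open>The square of a subdivision\<close>

lemma subdiv_point_last_eq_first:
  assumes "n > 0"
  shows "subdiv_point n u v (n - 1) = subdiv_point n v u 1"
  using subdiv_point_swap[of n 1 u v] assms by simp

text \<open>Case split on the middle vertex \<open>z\<close>. An inner \<open>z\<close> lies on one
  path only, and the walk continues along it, since turning back would give \<open>x = y\<close>. At
  an original \<open>z\<close> it passes from one edge to a different one.\<close>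

lemma n_subdivision_two_step:
  assumes "(x, z) \<in> parcs (n_subdivision G n)" "(z, y) \<in> parcs (n_subdivision G n)" "x \<noteq> y" "1 < n"
  shows "(\<exists>u v i. (u, v) \<in> parcs G \<and> i + 2 \<le> n \<and> x = subdiv_point n u v i \<and> y = subdiv_point n u v (i + 2))
    \<or> (\<exists>u v w. (v, u) \<in> parcs G \<and> (u, w) \<in> parcs G \<and> v \<noteq> w \<and>
         x = subdiv_point n v u (n - 1) \<and> y = subdiv_point n u w 1)"
proof -
  obtain u v i where x: "(u, v) \<in> parcs G" "i < n" "x = subdiv_point n u v i" "z = subdiv_point n u v (Suc i)"
    using assms(1) by (auto simp: n_subdivision_def)
  obtain u' v' j where y: "(u', v') \<in> parcs G" "j < n" "z = subdiv_point n u' v' j" "y = subdiv_point n u' v' (Suc j)"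
    using assms(2) by (auto simp: n_subdivision_def)
  show ?thesis
  proof (cases "Suc i = n")
    case True
    then have "z = Original v" using x by (simp add: subdiv_point_def)
    then have "j = 0" "u' = v" using y by (auto simp: subdiv_point_def split: if_splits)
    moreover have "v' \<noteq> u"
    proof
      assume "v' = u"
      then have "y = x"
        using x y True \<open>j = 0\<close> \<open>u' = v\<close> subdiv_point_last_eq_first[of n u v] assms(4) by auto
      then show False using assms(3) by simp
    qed
    ultimately show ?thesis using x y True by (intro disjI2 exI[of _ v] exI[of _ u] exI[of _ v']) auto
  next
    case False
    then have "j \<noteq> 0" using x(2,4) y(3) by (auto simp: subdiv_point_def split: if_splits)
    then consider "u' = u" "v' = v" "j = Suc i" | "u' = v" "v' = u" "j = n - Suc i"
      using subdiv_point_eq_iff[of "Suc i" n j u v u' v'] x y False by auto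
    then show ?thesis
    proof cases
      case 1
      then show ?thesis using x y by (intro disjI1 exI[of _ u] exI[of _ v] exI[of _ i]) auto
    next
      case 2
      then have "y = subdiv_point n v u (n - i)" using y x(2) by (simp add: Suc_diff_Suc)
      then have "y = x" using subdiv_point_swap[of n i v u] x assms(4) by simp
      then show ?thesis using assms(3) by simp
    qed
  qed
qed

text \<open>Vertices at distance at most 2 either lie on a common path, where \<open>q\<close>
  separates them, or are two half-edges at one original vertex \<open>u\<close>, where injectivity
  of \<open>h u\<close> does.\<close>

lemma ex_subdivision_square_coloring:
  assumes "pair_graph G" "3 \<le> n"
    and c: "\<And>u. u \<in> pverts G \<Longrightarrow> c u \<le> k"
    and q: "\<And>u v. (u, v) \<in> parcs G \<Longrightarrow>
       path_square_coloring n k (q u v) \<and> fits_ends n (c u) (h u v) (h v u) (c v) (q u v)"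
    and h: "\<And>u. inj_on (h u) (parcs G `` {u})"
  shows "\<exists>f. proper_coloring (graph_power (n_subdivision G n) 2) (Suc k) f"
proof -
  interpret pair_graph G by fact
  interpret H: pair_graph "n_subdivision G n"
    by (rule pair_graph_n_subdivision[OF assms(1)]) (use assms(2) in simp)
  have symG: "(v, u) \<in> parcs G" if "(u, v) \<in> parcs G" for u v
    using pair_sym_arcs that by (auto simp: symmetric_def sym_def)
  \<comment> \<open>\<open>q u v\<close> and \<open>q v u\<close> need not be reverses of each
    other. The numbering \<open>r\<close> selects one direction per edge, and \<open>Q\<close> reads
    that coloring from either end.\<close>
  obtain r :: "'a \<Rightarrow> nat" where r: "inj_on r (pverts G)"
    using finite_imp_inj_to_nat_seg[OF pair_finite_verts] by blast
  have rne: "r u \<noteq> r v" if "(u, v) \<in> parcs G" for u v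
    using inj_onD[OF r] that in_arcsD1 in_arcsD2 pair_no_loops by fastforce
  define Q where "Q u v = (if r u < r v then q u v else (\<lambda>i. q v u (n - i)))" for u v
  have Qrev: "Q v u (n - i) = Q u v i" if "(u, v) \<in> parcs G" "i \<le> n" for u v i
    using rne[OF that(1)] that(2) by (auto simp: Q_def)
  have Q: "path_square_coloring n k (Q u v)" "fits_ends n (c u) (h u v) (h v u) (c v) (Q u v)"
    if "(u, v) \<in> parcs G" for u v
    using q[OF that] q[OF symG[OF that]] path_square_coloring_rev assms(2)
    by (auto simp: Q_def fits_ends_def)
  \<comment> \<open>\<open>SOME\<close> picks one of the two names of an inner vertex; by
    \<open>Qrev\<close> both give the same color.\<close>
  define f where
    "f z = (case z of Original u \<Rightarrow> c u | Inner S \<Rightarrow> (case SOME p. p \<in> S of (u, v, i) \<Rightarrow> Q u v i))" for z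
  have f: "f (subdiv_point n u v i) = Q u v i" if "(u, v) \<in> parcs G" "i \<le> n" for u v i
  proof (cases "0 < i \<and> i < n")
    case True
    define p where "p = (SOME p. p \<in> {(u, v, i), (v, u, n - i)})"
    have "p \<in> {(u, v, i), (v, u, n - i)}" unfolding p_def by (rule someI[of _ "(u, v, i)"]) simp
    moreover have "f (subdiv_point n u v i) = (case p of (u, v, i) \<Rightarrow> Q u v i)"
      using True by (simp add: f_def subdiv_point_def p_def)
    ultimately show ?thesis using Qrev[OF that] by auto
  next
    case False
    then have "i = 0 \<or> i = n" using that(2) by auto
    then show ?thesis using Q(2)[OF that(1)] assms(2) by (auto simp: f_def subdiv_point_def fits_ends_def)
  qed
  have "f x < Suc k" if "x \<in> pverts (n_subdivision G n)" for x
    using that c f Q(1) unfolding n_subdivision_def path_square_coloring_def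
    by (fastforce simp: f_def less_Suc_eq_le)
  moreover have "f x \<noteq> f y" if xy: "(x, y) \<in> parcs (graph_power (n_subdivision G n) 2)" for x y
  proof -
    have "x \<noteq> y" using xy by (simp add: H.in_parcs_graph_square_iff)
    consider "(x, y) \<in> parcs (n_subdivision G n)"
      | z where "(x, z) \<in> parcs (n_subdivision G n)" "(z, y) \<in> parcs (n_subdivision G n)"
      using xy unfolding H.in_parcs_graph_square_iff by blast
    then show ?thesis
    proof cases
      case 1
      then obtain u v i where "(u, v) \<in> parcs G" "i < n"
        "x = subdiv_point n u v i" "y = subdiv_point n u v (Suc i)"
        by (auto simp: n_subdivision_def)
      then show ?thesis using Q(1) f by (simp add: path_square_coloring_def)
    next
      case 2
      have "1 < n" using assms(2) by simp
      from n_subdivision_two_step[OF 2 \<open>x \<noteq> y\<close> this] show ?thesis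
      proof (elim disjE exE conjE)
        fix u v i assume "(u, v) \<in> parcs G" "i + 2 \<le> n"
          "x = subdiv_point n u v i" "y = subdiv_point n u v (i + 2)"
        then show ?thesis using Q(1)[of u v] f by (simp add: path_square_coloring_def)
      next
        fix u v w assume *: "(v, u) \<in> parcs G" "(u, w) \<in> parcs G" "v \<noteq> w"
          "x = subdiv_point n v u (n - 1)" "y = subdiv_point n u w 1"
        then have "f x = h u v" "f y = h u w"
          using Q(2) f assms(2) by (auto simp: fits_ends_def)
        then show ?thesis using inj_onD[OF h[of u], of v w] * symG by auto
      qed
    qed
  qed
  ultimately show ?thesis
    unfolding proper_coloring_def by (intro exI[of _ f]) (auto simp: graph_power_def)
qed

text \<open>\<open>B\<close> will be \<open>n mod 3 = 2\<close>. If it holds, \<open>c\<close> is a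
  greedy coloring, and \<open>k\<close> colors other than \<open>c u\<close> remain for the at most
  \<open>k\<close> half-edges at \<open>u\<close>.\<close>

lemma ex_end_colors:
  assumes "pair_graph G" "\<And>u. card (parcs G `` {u}) \<le> k" "2 \<le> k"
  shows "\<exists>c h. (\<forall>u\<in>pverts G. c u \<le> k) \<and> (\<forall>u. inj_on (h u) (parcs G `` {u})) \<and>
    (\<forall>(u, v)\<in>parcs G. h u v \<le> k \<and> h u v \<noteq> c u \<and>
       (if B then c u \<noteq> c v else c u = c v \<and> h u v \<noteq> (h v u :: nat)))"
proof -
  interpret pair_graph G by fact
  have E: "sym (parcs G)" "irrefl (parcs G)"
    using pair_sym_arcs no_loops' by (auto simp: symmetric_def irrefl_def)
  show ?thesis
  proof (cases B)
    case True
    obtain c where c: "\<forall>u\<in>pverts G. c u \<le> k" "\<forall>u\<in>pverts G. \<forall>v\<in>pverts G. (u, v) \<in> parcs G \<longrightarrow> c u \<noteq> c v"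
      using greedy_coloring[OF pair_finite_verts pair_finite_arcs E assms(2)] by blast
    have "\<exists>g. g ` (parcs G `` {u}) \<subseteq> {..k} - {c u} \<and> inj_on g (parcs G `` {u})" for u
    proof (rule card_le_inj)
      have "k \<le> card ({..k} - {c u})" by (simp add: card_Diff_singleton_if)
      then show "card (parcs G `` {u}) \<le> card ({..k} - {c u})" using assms(2)[of u] by simp
    qed (simp_all add: finite_Image pair_finite_arcs)
    then obtain h where h: "\<And>u. h u ` (parcs G `` {u}) \<subseteq> {..k} - {c u} \<and> inj_on (h u) (parcs G `` {u})"
      by metis
    have "h u v \<le> k" "h u v \<noteq> c u" "c u \<noteq> c v" if "(u, v) \<in> parcs G" for u v
      using h[of u] c that in_arcsD1[OF that] in_arcsD2[OF that] by auto
    then show ?thesis using c h True by (intro exI[of _ c] exI[of _ h]) auto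
  next
    case False
    obtain h where "halfedge_coloring (parcs G) k h"
      using ex_halfedge_coloring[OF pair_finite_arcs E assms(2,3)] by blast
    \<comment> \<open>\<open>Suc\<close> moves the \<open>k\<close> half-edge colors to
      \<open>1\<close> through \<open>k\<close>, leaving \<open>0\<close> for all original
      vertices.\<close>
    then show ?thesis using False
      by (intro exI[of _ "\<lambda>_. 0"] exI[of _ "\<lambda>u v. Suc (h u v)"])
        (auto simp: halfedge_coloring_def inj_on_def Suc_le_eq)
  qed
qed

text \<open>The inner neighbors of \<open>Original u\<close> are pairwise joined by walks of length
  2 through it.\<close>

lemma clique_subdivision_square:
  assumes "pair_graph G" "2 \<le> n" "u \<in> pverts G"
  shows "\<exists>S. clique (graph_power (n_subdivision G n) 2) S \<and> card S = Suc (card (parcs G `` {u}))"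
proof -
  interpret pair_graph G by fact
  interpret H: pair_graph "n_subdivision G n"
    by (rule pair_graph_n_subdivision[OF assms(1)]) (use assms(2) in simp)
  let ?p = "\<lambda>v. subdiv_point n u v 1"
  let ?N = "?p ` (parcs G `` {u})"
  have arc: "(Original u, ?p v) \<in> parcs (n_subdivision G n)" if "(u, v) \<in> parcs G" for v
    using that assms(2) by (force simp: n_subdivision_def subdiv_point_def)
  then have rev: "(?p v, Original u) \<in> parcs (n_subdivision G n)" if "(u, v) \<in> parcs G" for v
    using H.pair_sym_arcs that by (auto simp: symmetric_def sym_def)
  have "clique (graph_power (n_subdivision G n) 2) (insert (Original u) ?N)"
    unfolding clique_def
  proof (intro conjI ballI impI)
    show "insert (Original u) ?N \<subseteq> pverts (graph_power (n_subdivision G n) 2)"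
      using assms(3) arc H.in_arcsD2 by (auto simp: graph_power_def) (auto simp: n_subdivision_def)
  next
    fix x y assume "x \<in> insert (Original u) ?N" "y \<in> insert (Original u) ?N" "x \<noteq> y"
    then show "(x, y) \<in> parcs (graph_power (n_subdivision G n) 2)"
      unfolding H.in_parcs_graph_square_iff using arc rev by blast
  qed
  moreover have "inj_on ?p (parcs G `` {u})"
    using assms(2) by (auto simp: inj_on_def subdiv_point_def doubleton_eq_iff)
  then have "card (insert (Original u) ?N) = Suc (card (parcs G `` {u}))"
    using assms(2) pair_finite_arcs
    by (subst card_insert_disjoint) (auto simp: finite_Image card_image subdiv_point_def)
  ultimately show ?thesis by blast
qed

theorem theorem3:
  fixes G :: "'a pair_pre_digraph" and n :: nat
  assumes "pair_graph G"
    and "Digraph_Component.connected (with_proj G)"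
    and "max_degree G \<ge> 3"
    and "n > 2"
  shows "chromatic_number (fractional_power G 2 n) = max_degree G + 1
       \<and> max_degree G + 1 = clique_number (fractional_power G 2 n)"
proof -
  interpret pair_graph G by fact
  interpret H: pair_graph "n_subdivision G n"
    by (rule pair_graph_n_subdivision[OF assms(1)]) (use assms(4) in simp)
  let ?k = "max_degree G"
  \<comment> \<open>Connectedness supplies a vertex, so the maximum is attained.\<close>
  have nonempty: "pverts G \<noteq> {}"
    using assms(2) unfolding connected_def strongly_connected_def by auto
  have maxdeg: "?k = Max ((\<lambda>u. card (parcs G `` {u})) ` pverts G)"
    by (simp add: max_degree_def out_degree_with_proj)
  have deg: "card (parcs G `` {u}) \<le> ?k" for u
  proof (cases "u \<in> pverts G")
    case True
    then show ?thesis unfolding maxdeg using pair_finite_verts by (intro Max_ge) auto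
  next
    case False
    then have "parcs G `` {u} = {}" using in_arcsD1 by blast
    then show ?thesis by simp
  qed
  have "?k \<in> (\<lambda>u. card (parcs G `` {u})) ` pverts G"
    unfolding maxdeg using nonempty pair_finite_verts by (intro Max_in) auto
  then obtain u where "u \<in> pverts G" "card (parcs G `` {u}) = ?k" by auto
  then obtain S where S: "clique (fractional_power G 2 n) S" "card S = ?k + 1"
    using clique_subdivision_square[OF assms(1), of n u] assms(4) by (auto simp: fractional_power_def)
  obtain c h where ch: "\<forall>u\<in>pverts G. c u \<le> ?k" "\<forall>u. inj_on (h u) (parcs G `` {u})"
    and ends: "\<forall>(u, v)\<in>parcs G. h u v \<le> ?k \<and> h u v \<noteq> c u \<and>
       (if n mod 3 = 2 then c u \<noteq> c v else c u = c v \<and> h u v \<noteq> h v u)"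
    using ex_end_colors[OF assms(1) deg, of "n mod 3 = 2"] assms(3) by auto
  have "\<exists>q. path_square_coloring n ?k q \<and> fits_ends n (c u) (h u v) (h v u) (c v) q"
    if "(u, v) \<in> parcs G" for u v
  proof -
    \<comment> \<open>The opposite arc gives the conditions on \<open>h v u\<close>, the half-edge
      color at the far end.\<close>
    have "(v, u) \<in> parcs G" using pair_sym_arcs that by (auto simp: symmetric_def sym_def)
    then show ?thesis
      using that ends ch(1) in_arcsD1[OF that] in_arcsD2[OF that] assms(3,4)
      by (intro ex_path_square_coloring) auto
  qed
  then obtain q where "\<And>u v. (u, v) \<in> parcs G \<Longrightarrow> path_square_coloring n ?k (q u v) \<and>
      fits_ends n (c u) (h u v) (h v u) (c v) (q u v)"
    by metis
  then obtain f where f: "proper_coloring (fractional_power G 2 n) (?k + 1) f"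
    using ex_subdivision_square_coloring[OF assms(1), of n c ?k q h] ch assms(4)
    by (auto simp: fractional_power_def)
  have "finite (pverts (fractional_power G 2 n))"
    using H.pair_finite_verts by (simp add: fractional_power_def graph_power_def)
  from chromatic_and_clique_number_eqI[OF this f S] show ?thesis by simp
qed

end
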